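(* Let $\Lambda=\{\lambda_n\}_{n\ge 1}$ be a sequence of real numbers with $1<\lambda_1\le\lambda_2\le\cdots$ and $\lim_{n\to\infty}\lambda_n=\infty$ (the series $\sum_{n=1}^\infty 1/\lambda_n$ may converge or diverge). Let $\{p(n)\}_{n\ge1}$ be an increasing sequence of real numbers with $p(n)\ge 1$ for all $n$ and $p(n)\to\infty$ as $n\to\infty$. Then $BV^{\#}(p(n)\uparrow\infty)\subset\Lambda^{\#}BV$ if and only if $\Lambda^{\#}BV=B(I^2)$.
   Context: All functions $f$ are real-valued measurable functions on $\mathbb{R}^2$ that are $1$-periodic in each variable. Let $I=[0,1]$ and $I^2=[0,1]\times[0,1]$; $B(I^2)$ denotes the set of all such functions that are bounded on $I^2$. For an interval $J$ with endpoints $a<b$ and a point $x$ or $y$, put $f(J,y)=f(b,y)-f(a,y)$ and $f(x,J)=f(x,b)-f(x,a)$. Class $\Lambda^{\#}BV$: let $\Omega$ be the set of all (finite or countable) collections $\{I_i\}$ of nonoverlapping subintervals of $I$, indexed in arbitrary order. Define $$\Lambda^{\#}V_1(f)=\sup_{\{y_i\}\subset I}\ \sup_{\{I_i\}\in\Omega}\ \sum_i\frac{|f(I_i,y_i)|}{\lambda_i},\qquad \Lambda^{\#}V_2(f)=\sup_{\{x_j\}\subset I}\ \sup_{\{J_j\}\in\Omega}\ \sum_j\frac{|f(x_j,J_j)|}{\lambda_j}.$$ Then $f\in\Lambda^{\#}BV$ if $\Lambda^{\#}V_1(f)+\Lambda^{\#}V_2(f)<\infty$. Class $BV^{\#}(p(n)\uparrow\infty)$: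 a partition with period $1$ is a strictly increasing doubly infinite sequence $\Delta:\ \cdots<t_{-1}<t_0<t_1<\cdots$ of reals for which there is a positive integer $m$ (depending on $\Delta$) with $t_{k+m}=t_k+1$ for all $k\in\mathbb{Z}$; its intervals are $I_i=(t_{i-1},t_i)$, $i=1,\dots,m$, of length $|I_i|=t_i-t_{i-1}$. Define $$V_1^{\#}(f,p(n)\uparrow\infty)=\sup_{\{y_i\}\subset I}\ \sup_{n\ge1}\ \sup_{\Delta}\Big\{\Big(\sum_{i=1}^{m}|f(I_i,y_i)|^{p(n)}\Big)^{1/p(n)}:\ \inf_i|I_i|\ge 2^{-n}\Big\},$$ $$V_2^{\#}(f,p(n)\uparrow\infty)=\sup_{\{x_j\}\subset I}\ \sup_{n\ge1}\ \sup_{\Delta}\Big\{\Big(\sum_{j=1}^{m}|f(x_j,I_j)|^{p(n)}\Big)^{1/p(n)}:\ \inf_j|I_j|\ge 2^{-n}\Big\},$$ the suprema over $\Delta$ being over all partitions with period $1$ satisfying the stated length condition. Then $f\in BV^{\#}(p(n)\uparrow\infty)$ if both $V_1^{\#}(f,p(n)\uparrow\infty)$ and $V_2^{\#}(f,p(n)\uparrow\infty)$ are finite. *)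

theory Defs
  imports "HOL-Analysis.Analysis"
begin

definition periodic_measurable :: "(real \<times> real \<Rightarrow> real) set" where
  "periodic_measurable =
     {f. f \<in> borel_measurable lebesgue \<and>
         (\<forall>x y. f (x + 1, y) = f (x, y)) \<and> (\<forall>x y. f (x, y + 1) = f (x, y))}"

definition bounded_functions :: "(real \<times> real \<Rightarrow> real) set" where
  "bounded_functions = {f \<in> periodic_measurable. bounded (f ` ({0..1} \<times> {0..1}))}"

(* An interval enters only through its two endpoints, so it is represented by the
   ordered pair of them; all sequences are indexed from 1. *)

definition incr1 :: "(real \<times> real \<Rightarrow> real) \<Rightarrow> real \<times> real \<Rightarrow> real \<Rightarrow> real" where
  "incr1 f J y = f (snd J, y) - f (fst J, y)"

definition incr2 :: "(real \<times> real \<Rightarrow> real) \<Rightarrow> real \<Rightarrow> real \<times> real \<Rightarrow> real" where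
  "incr2 f x J = f (x, snd J) - f (x, fst J)"

definition unit_points :: "(nat \<Rightarrow> real) set" where
  "unit_points = {y. range y \<subseteq> {0..1}}"

(* A collection is a pair (N, J): the index set N is an initial segment {1..k} or all of
   {1..}, and J i is the i-th interval. Nonoverlapping means disjoint interiors. No order
   of the J i on the line is imposed, so every enumeration is included. *)

definition interval_collections :: "(nat set \<times> (nat \<Rightarrow> real \<times> real)) set" where
  "interval_collections =
     {(N, J). (N = {1..} \<or> (\<exists>k. N = {1..k})) \<and>
              (\<forall>i\<in>N. 0 \<le> fst (J i) \<and> fst (J i) < snd (J i) \<and> snd (J i) \<le> 1) \<and>
              disjoint_family_on (\<lambda>i. {fst (J i)<..<snd (J i)}) N}"

(* Values in the extended nonnegative reals: a supremum is infinite exactly when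
   the quantities are unbounded. *)

definition Lambda_V1 :: "(nat \<Rightarrow> real) \<Rightarrow> (real \<times> real \<Rightarrow> real) \<Rightarrow> ennreal" where
  "Lambda_V1 lam f =
     (SUP y\<in>unit_points. SUP (N, J)\<in>interval_collections.
        \<Sum>\<^sub>\<infinity>i\<in>N. ennreal (\<bar>incr1 f (J i) (y i)\<bar> / lam i))"

definition Lambda_V2 :: "(nat \<Rightarrow> real) \<Rightarrow> (real \<times> real \<Rightarrow> real) \<Rightarrow> ennreal" where
  "Lambda_V2 lam f =
     (SUP x\<in>unit_points. SUP (N, J)\<in>interval_collections.
        \<Sum>\<^sub>\<infinity>j\<in>N. ennreal (\<bar>incr2 f (x j) (J j)\<bar> / lam j))"

definition Lambda_BV :: "(nat \<Rightarrow> real) \<Rightarrow> (real \<times> real \<Rightarrow> real) set" where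
  "Lambda_BV lam = {f \<in> periodic_measurable. Lambda_V1 lam f + Lambda_V2 lam f < \<infinity>}"

definition partition_period1 :: "(int \<Rightarrow> real) \<Rightarrow> nat \<Rightarrow> bool" where
  "partition_period1 t m \<longleftrightarrow> strict_mono t \<and> m > 0 \<and> (\<forall>k. t (k + int m) = t k + 1)"

definition part_interval :: "(int \<Rightarrow> real) \<Rightarrow> nat \<Rightarrow> real \<times> real" where
  "part_interval t i = (t (int i - 1), t (int i))"

definition fine_partitions :: "nat \<Rightarrow> ((int \<Rightarrow> real) \<times> nat) set" where
  "fine_partitions n =
     {(t, m). partition_period1 t m \<and>
              (INF i\<in>{1..m}. snd (part_interval t i) - fst (part_interval t i)) \<ge> 1 / 2 ^ n}"

definition BV_V1 :: "(nat \<Rightarrow> real) \<Rightarrow> (real \<times> real \<Rightarrow> real) \<Rightarrow> ennreal" where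
  "BV_V1 p f =
     (SUP y\<in>unit_points. SUP n\<in>{1..}. SUP (t, m)\<in>fine_partitions n.
        ennreal ((\<Sum>i=1..m. \<bar>incr1 f (part_interval t i) (y i)\<bar> powr p n) powr (1 / p n)))"

definition BV_V2 :: "(nat \<Rightarrow> real) \<Rightarrow> (real \<times> real \<Rightarrow> real) \<Rightarrow> ennreal" where
  "BV_V2 p f =
     (SUP x\<in>unit_points. SUP n\<in>{1..}. SUP (t, m)\<in>fine_partitions n.
        ennreal ((\<Sum>j=1..m. \<bar>incr2 f (x j) (part_interval t j)\<bar> powr p n) powr (1 / p n)))"

definition BV_sharp :: "(nat \<Rightarrow> real) \<Rightarrow> (real \<times> real \<Rightarrow> real) set" where
  "BV_sharp p = {f \<in> periodic_measurable. BV_V1 p f < \<infinity> \<and> BV_V2 p f < \<infinity>}"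

end

theory Submission
  imports Defs
begin

text \<open>
  Both classes consist of bounded functions, so only \<open>bounded_functions \<subseteq> Lambda_BV lam\<close> is at stake.
  Choose \<open>r\<close> strictly increasing with \<open>p (r j) \<ge> j\<close> and let \<open>f (x, y)\<close> be the indicator of
  \<open>frac x \<in> {1 / 2 ^ r j}\<close>. A partition of mesh at least \<open>1 / 2 ^ n\<close> meets this set in at most
  one point below \<open>1 / 2 ^ n\<close> and in at most \<open>p n + 1\<close> points above it, so its \<open>p n\<close>-variation is
  at most a constant times \<open>p n powr (1 / p n)\<close> and hence bounded: \<open>f\<close> lies in \<open>BV_sharp p\<close>.
  If \<open>f\<close> also lies in \<open>Lambda_BV lam\<close>, testing against small intervals starting at the points
  \<open>1 / 2 ^ r j\<close> shows that the series of the \<open>1 / lam j\<close> converges, and then every bounded function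
  lies in \<open>Lambda_BV lam\<close>.
\<close>

section \<open>Boundedness\<close>

text \<open>Exchanging the coordinates turns variation in the second variable into variation in the
  first, so the estimates below treat the first variable only.\<close>

lemma incr2_swap: "incr2 f x J = incr1 (f \<circ> prod.swap) J x"
  by (simp add: incr1_def incr2_def)

lemma Lambda_V2_swap: "Lambda_V2 lam f = Lambda_V1 lam (f \<circ> prod.swap)"
  unfolding Lambda_V1_def Lambda_V2_def incr2_swap ..

lemma BV_V2_swap: "BV_V2 p f = BV_V1 p (f \<circ> prod.swap)"
  unfolding BV_V1_def BV_V2_def incr2_swap ..

lemma const_unit_points: "c \<in> {0..1} \<Longrightarrow> (\<lambda>_. c) \<in> unit_points"
  by (auto simp: unit_points_def)

text \<open>Triangle inequality along the path from \<open>(x, y)\<close> to \<open>(0, y)\<close>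
  to \<open>(0, 0)\<close>: uniform control of horizontal increments plus one vertical section
  suffices.\<close>

lemma bounded_functions_if_sections_bounded:
  assumes "f \<in> periodic_measurable"
    and A: "\<And>x y. x \<in> {0..1} \<Longrightarrow> y \<in> {0..1} \<Longrightarrow> \<bar>f (x, y) - f (0, y)\<bar> \<le> A"
    and B: "\<And>y. y \<in> {0..1} \<Longrightarrow> \<bar>f (0, y) - f (0, 0)\<bar> \<le> B"
  shows "f \<in> bounded_functions"
proof -
  have "\<bar>f (x, y)\<bar> \<le> A + B + \<bar>f (0, 0)\<bar>" if "x \<in> {0..1}" "y \<in> {0..1}" for x y
    using A[OF that] B[OF that(2)] by linarith
  then have "bounded (f ` ({0..1} \<times> {0..1}))"
    unfolding bounded_iff by (intro exI[of _ "A + B + \<bar>f (0, 0)\<bar>"]) auto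
  then show ?thesis
    using assms(1) by (simp add: bounded_functions_def)
qed

lemma Lambda_V1_ge:
  assumes "y \<in> unit_points" "(N, J) \<in> interval_collections"
  shows "(\<Sum>\<^sub>\<infinity>i\<in>N. ennreal (\<bar>incr1 f (J i) (y i)\<bar> / lam i)) \<le> Lambda_V1 lam f"
  unfolding Lambda_V1_def
  by (rule SUP_upper2[OF assms(1)], rule SUP_upper2[OF assms(2)]) simp

text \<open>The collection whose only interval is \<open>(0, x)\<close>, taken with weight
  \<open>lam 1\<close>, already sees the increment in question.\<close>

lemma Lambda_V1_bounds_sections:
  assumes "0 < lam 1" "Lambda_V1 lam f < \<infinity>"
  shows "\<exists>A. \<forall>x\<in>{0..1}. \<forall>y\<in>{0..1}. \<bar>f (x, y) - f (0, y)\<bar> \<le> A"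
proof -
  obtain V where V: "0 \<le> V" "Lambda_V1 lam f = ennreal V"
    using assms(2) by (cases "Lambda_V1 lam f") auto
  have "\<bar>f (x, y) - f (0, y)\<bar> \<le> lam 1 * V" if "x \<in> {0..1}" "y \<in> {0..1}" for x y
  proof (cases "x = 0")
    case False
    have "({1..1}, \<lambda>_. (0, x)) \<in> interval_collections"
      using that False unfolding interval_collections_def
      by (intro CollectI case_prodI conjI disjI2 exI[of _ 1]) (auto simp: disjoint_family_on_def)
    from Lambda_V1_ge[OF const_unit_points[OF that(2)] this, of f lam]
    have "\<bar>f (x, y) - f (0, y)\<bar> / lam 1 \<le> V"
      using V by (simp add: incr1_def)
    then show ?thesis
      using assms(1) by (simp add: divide_le_eq mult.commute)
  qed (use assms V in simp)
  then show ?thesis by blast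
qed

lemma Lambda_BV_bounded:
  assumes "0 < lam 1"
  shows "Lambda_BV lam \<subseteq> bounded_functions"
proof
  fix f assume f: "f \<in> Lambda_BV lam"
  then have "Lambda_V1 lam f < \<infinity>" "Lambda_V1 lam (f \<circ> prod.swap) < \<infinity>"
    by (auto simp: Lambda_BV_def Lambda_V2_swap)
  from Lambda_V1_bounds_sections[OF assms this(1)] Lambda_V1_bounds_sections[OF assms this(2)]
  obtain A B where
    "\<forall>x\<in>{0..1}. \<forall>y\<in>{0..1}. \<bar>f (x, y) - f (0, y)\<bar> \<le> A"
    "\<forall>x\<in>{0..1}. \<forall>y\<in>{0..1}. \<bar>f (y, x) - f (y, 0)\<bar> \<le> B"
    unfolding o_apply swap_simp by blast
  with f show "f \<in> bounded_functions"
    by (intro bounded_functions_if_sections_bounded[of f A B]) (auto simp: Lambda_BV_def)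
qed

section \<open>Boundedness from finite \<open>p n\<close>-variation\<close>

lemma fine_partitions_gap:
  assumes "(t, m) \<in> fine_partitions n" "i \<in> {1..m}"
  shows "1 / 2 ^ n \<le> t (int i) - t (int i - 1)"
proof -
  have "1 / 2 ^ n \<le> (INF i\<in>{1..m}. t (int i) - t (int i - 1))"
    using assms(1) by (simp add: fine_partitions_def part_interval_def)
  also have "\<dots> \<le> t (int i) - t (int i - 1)"
    using assms(2) by (intro cINF_lower) auto
  finally show ?thesis .
qed

text \<open>Even indices give the integer translates of \<open>a\<close>, odd ones those of
  \<open>b\<close>. The gaps \<open>b - a\<close> and \<open>a + 1 - b\<close> are both at least
  \<open>1 / 4\<close>, which is the mesh allowed at level 2.\<close>

lemma two_interval_partition:
  fixes a b :: real
  assumes "a + 1 / 4 \<le> b" "b \<le> a + 3 / 4"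
  defines "t \<equiv> \<lambda>k::int. (if even k then a else b) + of_int (k div 2)"
  shows "(t, 2) \<in> fine_partitions 2"
proof -
  have step: "t k < t (k + 1)" for k
    using assms(1,2) unfolding t_def by (cases "even k") (auto elim!: evenE oddE)
  have "t i < t j" if "i < j" for i j
    using that
  proof (induction j rule: int_gr_induct)
    case (step j)
    then show ?case using \<open>\<And>k. t k < t (k + 1)\<close> less_trans by blast
  qed (fact step)
  then have "strict_mono t" by (rule strict_monoI)
  moreover have "t (k + int 2) = t k + 1" for k
    by (auto simp: t_def)
  moreover have "(INF i\<in>{1..2::nat}. t (int i) - t (int i - 1)) \<ge> 1 / 2 ^ 2"
  proof (rule cINF_greatest)
    fix i :: nat assume "i \<in> {1..2}"
    then have "i = 1 \<or> i = 2" by auto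
    then show "1 / 2 ^ 2 \<le> t (int i) - t (int i - 1)"
      using assms(1,2) by (auto simp: t_def)
  qed simp
  ultimately show ?thesis
    by (simp add: fine_partitions_def partition_period1_def part_interval_def)
qed

lemma BV_V1_ge:
  assumes "y \<in> unit_points" "1 \<le> n" "(t, m) \<in> fine_partitions n"
  shows "ennreal ((\<Sum>i=1..m. \<bar>incr1 f (part_interval t i) (y i)\<bar> powr p n) powr (1 / p n)) \<le> BV_V1 p f"
  unfolding BV_V1_def
  by (rule SUP_upper2[OF assms(1)], rule SUP_upper2[of n], use assms in simp,
      rule SUP_upper2[OF assms(3)]) simp

text \<open>The increment from \<open>a\<close> to \<open>b\<close> is one entry of the variation
  sum at level 2, and an l^p norm dominates each entry.\<close>

lemma BV_V1_bounds_increment: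
  assumes "1 \<le> p 2" "BV_V1 p f = ennreal V" "0 \<le> V" "y \<in> {0..1}"
    and "a + 1 / 4 \<le> b" "b \<le> a + 3 / 4"
  shows "\<bar>f (b, y) - f (a, y)\<bar> \<le> V"
proof -
  define t where "t = (\<lambda>k::int. (if even k then a else b) + of_int (k div 2))"
  let ?F = "\<lambda>i. \<bar>incr1 f (part_interval t i) y\<bar>"
  have "(t, 2) \<in> fine_partitions 2"
    unfolding t_def using assms(5,6) by (rule two_interval_partition)
  from BV_V1_ge[OF const_unit_points[OF assms(4)] _ this, of f p]
  have le: "(\<Sum>i=1..2. ?F i powr p 2) powr (1 / p 2) \<le> V"
    using assms(2,3) by simp
  have "\<bar>f (b, y) - f (a, y)\<bar> = ?F 1"
    by (simp add: incr1_def part_interval_def t_def)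
  also have "\<dots> = (?F 1 powr p 2) powr (1 / p 2)"
    using assms(1) by (simp add: powr_powr)
  also have "\<dots> \<le> (\<Sum>i=1..2. ?F i powr p 2) powr (1 / p 2)"
    using assms(1) by (intro powr_mono2 member_le_sum) auto
  finally show ?thesis using le by simp
qed

lemma BV_V1_bounds_sections:
  assumes "1 \<le> p 2" "BV_V1 p f < \<infinity>"
  shows "\<exists>A. \<forall>x\<in>{0..1}. \<forall>y\<in>{0..1}. \<bar>f (x, y) - f (0, y)\<bar> \<le> A"
proof -
  obtain V where V: "0 \<le> V" "BV_V1 p f = ennreal V"
    using assms(2) by (cases "BV_V1 p f") auto
  note inc = BV_V1_bounds_increment[OF assms(1) V(2,1)]
  have "\<bar>f (x, y) - f (0, y)\<bar> \<le> 2 * V" if "x \<in> {0..1}" "y \<in> {0..1}" for x y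
  \<comment> \<open>The interval from 0 to \<open>x\<close> may be too short or too long for level
    2. A detour through \<open>3/4\<close> or \<open>1/4\<close> makes both legs have length between
    \<open>1/4\<close> and \<open>3/4\<close>.\<close>
  proof (cases "x \<le> 1 / 2")
    case True
    then show ?thesis
      using that inc[OF that(2), of 0 "3/4"] inc[OF that(2), of x "3/4"] by auto
  next
    case False
    then show ?thesis
      using that inc[OF that(2), of 0 "1/4"] inc[OF that(2), of "1/4" x] by auto
  qed
  then show ?thesis by blast
qed

lemma BV_sharp_bounded:
  assumes "1 \<le> p 2"
  shows "BV_sharp p \<subseteq> bounded_functions"
proof
  fix f assume f: "f \<in> BV_sharp p"
  then have "BV_V1 p f < \<infinity>" "BV_V1 p (f \<circ> prod.swap) < \<infinity>"
    by (auto simp: BV_sharp_def BV_V2_swap)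
  from BV_V1_bounds_sections[OF assms this(1)] BV_V1_bounds_sections[OF assms this(2)]
  obtain A B where
    "\<forall>x\<in>{0..1}. \<forall>y\<in>{0..1}. \<bar>f (x, y) - f (0, y)\<bar> \<le> A"
    "\<forall>x\<in>{0..1}. \<forall>y\<in>{0..1}. \<bar>f (y, x) - f (y, 0)\<bar> \<le> B"
    unfolding o_apply swap_simp by blast
  with f show "f \<in> bounded_functions"
    by (intro bounded_functions_if_sections_bounded[of f A B]) (auto simp: BV_sharp_def)
qed

section \<open>Bounded functions when the reciprocals are summable\<close>

text \<open>Every increment is at most \<open>2 * M\<close>, so each variation sum is dominated by
  \<open>2 * M\<close> times the series of reciprocals, whatever the intervals are. Comparing finite
  partial sums is enough.\<close>

lemma Lambda_V1_finite_if_bounded: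
  assumes "\<And>i. 1 \<le> i \<Longrightarrow> 0 < lam i"
    and fin: "(\<Sum>\<^sub>\<infinity>i\<in>{1..}. ennreal (1 / lam i)) < \<infinity>"
    and M: "\<And>x y. x \<in> {0..1} \<Longrightarrow> y \<in> {0..1} \<Longrightarrow> \<bar>f (x, y)\<bar> \<le> M"
  shows "Lambda_V1 lam f < \<infinity>"
proof -
  let ?L = "\<Sum>\<^sub>\<infinity>i\<in>{1..}. ennreal (1 / lam i)"
  have "(\<Sum>\<^sub>\<infinity>i\<in>N. ennreal (\<bar>incr1 f (J i) (y i)\<bar> / lam i)) \<le> ennreal (2 * M) * ?L"
    if y: "y \<in> unit_points" and J: "(N, J) \<in> interval_collections" for y N J
  proof (rule infsum_le_finite_sums)
    fix F assume F: "finite F" "F \<subseteq> N"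
    have N: "N \<subseteq> {1..}"
      using J by (auto simp: interval_collections_def)
    have "(\<Sum>i\<in>F. ennreal (\<bar>incr1 f (J i) (y i)\<bar> / lam i)) \<le> (\<Sum>i\<in>F. ennreal (2 * M) * ennreal (1 / lam i))"
    proof (rule sum_mono)
      fix i assume "i \<in> F"
      with F N have i: "i \<in> N" "1 \<le> i" by auto
      have "0 \<le> fst (J i) \<and> fst (J i) < snd (J i) \<and> snd (J i) \<le> 1"
        using J i unfolding interval_collections_def by blast
      moreover have "y i \<in> {0..1}"
        using y unfolding unit_points_def by blast
      ultimately have "\<bar>f (fst (J i), y i)\<bar> \<le> M" "\<bar>f (snd (J i), y i)\<bar> \<le> M"
        by (simp_all add: M)
      then
      have "\<bar>incr1 f (J i) (y i)\<bar> \<le> 2 * M" by (simp add: incr1_def)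
      with assms(1)[OF i(2)] show "ennreal (\<bar>incr1 f (J i) (y i)\<bar> / lam i) \<le> ennreal (2 * M) * ennreal (1 / lam i)"
        by (subst ennreal_mult'[symmetric]) (auto intro!: ennreal_leI divide_right_mono)
    qed
    also have "\<dots> = ennreal (2 * M) * (\<Sum>i\<in>F. ennreal (1 / lam i))"
      by (simp add: sum_distrib_left)
    also have "\<dots> \<le> ennreal (2 * M) * ?L"
      using F N by (intro mult_left_mono) (auto simp: nonneg_infsum_complete intro!: SUP_upper)
    finally show "(\<Sum>i\<in>F. ennreal (\<bar>incr1 f (J i) (y i)\<bar> / lam i)) \<le> ennreal (2 * M) * ?L" .
  qed (intro nonneg_summable_on_complete, simp)
  then have "Lambda_V1 lam f \<le> ennreal (2 * M) * ?L"
    unfolding Lambda_V1_def by (intro SUP_least) auto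
  also have "\<dots> < \<infinity>"
    using fin by (simp add: ennreal_mult_less_top)
  finally show ?thesis .
qed

lemma bounded_functions_subset_Lambda_BV:
  assumes "\<And>i. 1 \<le> i \<Longrightarrow> 0 < lam i"
    and "(\<Sum>\<^sub>\<infinity>i\<in>{1..}. ennreal (1 / lam i)) < \<infinity>"
  shows "bounded_functions \<subseteq> Lambda_BV lam"
proof
  fix f assume f: "f \<in> bounded_functions"
  then obtain M where "\<forall>z\<in>{0..1} \<times> {0..1}. \<bar>f z\<bar> \<le> M"
    by (auto simp: bounded_functions_def bounded_iff)
  then have M: "\<And>x y. x \<in> {0..1} \<Longrightarrow> y \<in> {0..1} \<Longrightarrow> \<bar>f (x, y)\<bar> \<le> M"
    "\<And>x y. x \<in> {0..1} \<Longrightarrow> y \<in> {0..1} \<Longrightarrow> \<bar>(f \<circ> prod.swap) (x, y)\<bar> \<le> M"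
    by auto
  have "Lambda_V1 lam f < \<infinity>" "Lambda_V1 lam (f \<circ> prod.swap) < \<infinity>"
    using Lambda_V1_finite_if_bounded[of lam, OF assms] M by blast+
  with f show "f \<in> Lambda_BV lam"
    by (simp add: Lambda_BV_def Lambda_V2_swap bounded_functions_def)
qed

section \<open>Indicators of sets of dyadic points\<close>

definition dyadic_points :: "nat set \<Rightarrow> real set" where
  "dyadic_points R = (\<lambda>k. 1 / 2 ^ k) ` R"

text \<open>Taking \<open>frac\<close> makes the function periodic; as only the first coordinate
  enters, all increments in the second variable vanish.\<close>

definition dyadic_ind :: "nat set \<Rightarrow> real \<times> real \<Rightarrow> real" where
  "dyadic_ind R z = of_bool (frac (fst z) \<in> dyadic_points R)"

text \<open>The support in the first variable is covered by the integer translates of a countable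
  set, hence is countable and Borel.\<close>

lemma dyadic_ind_measurable: "dyadic_ind R \<in> periodic_measurable"
proof -
  let ?S = "{x. frac x \<in> dyadic_points R}"
  have "?S \<subseteq> (\<lambda>(s, k). s + of_int k) ` (dyadic_points R \<times> (UNIV :: int set))"
  proof
    fix x assume "x \<in> ?S"
    moreover have "x = frac x + of_int \<lfloor>x\<rfloor>" by (simp add: frac_def)
    ultimately show "x \<in> (\<lambda>(s, k). s + of_int k) ` (dyadic_points R \<times> (UNIV :: int set))"
      by (auto intro!: image_eqI[of _ _ "(frac x, \<lfloor>x\<rfloor>)"])
  qed
  moreover have "countable (dyadic_points R \<times> (UNIV :: int set))"
    by (auto simp: dyadic_points_def)
  ultimately have "countable ?S"
    using countable_subset by blast
  then have "?S \<in> sets borel"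
    by (rule sets.countable[rotated]) (simp add: borel_closed)
  then have "indicator ?S \<circ> fst \<in> borel_measurable (borel :: (real \<times> real) measure)"
    by (intro measurable_comp[OF borel_measurable_continuous_onI borel_measurable_indicator])
      (auto intro!: continuous_intros)
  moreover have "dyadic_ind R = indicator ?S \<circ> fst"
    by (auto simp: dyadic_ind_def indicator_def)
  ultimately have "dyadic_ind R \<in> borel_measurable borel" by metis
  then have "dyadic_ind R \<in> borel_measurable lebesgue"
    by (intro measurable_completion) simp
  then show ?thesis
    by (simp add: periodic_measurable_def dyadic_ind_def frac_def)
qed

text \<open>Points of the partition below \<open>1 / 2 ^ n\<close> modulo 1 are all sent to the extra label \<open>Suc n\<close>,
  which is therefore attained at most once.\<close>
lemma card_partition_dyadic_points:
  fixes a :: int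
  assumes part: "(t, m) \<in> fine_partitions n" and a: "a \<in> {0, 1}"
  shows "card {i \<in> {a..<a + int m}. frac (t i) \<in> dyadic_points R} \<le> card (R \<inter> {..n}) + 1"
    (is "card ?A \<le> _")
proof -
  let ?e = "1 / 2 ^ n :: real"
  have mono: "strict_mono t" and per: "\<And>k. t (k + int m) = t k + 1"
    using part by (auto simp: fine_partitions_def partition_period1_def)
  have gap: "?e \<le> t k - t (k - 1)" if "1 \<le> k" "k \<le> int m" for k
    using fine_partitions_gap[OF part, of "nat k"] that by (simp add: Suc_le_eq nat_le_iff)
  \<comment> \<open>The indices from \<open>a\<close> to \<open>a + int m - 1\<close> cover one
    period, so two of these points are at least one gap apart, and at least one gap short of a full
    period.\<close>
  have apart: "?e \<le> t j - t i" "t j - t i \<le> 1 - ?e"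
    if ij: "i < j" "i \<in> {a..<a + int m}" "j \<in> {a..<a + int m}" for i j
  proof -
    have "t i \<le> t (j - 1)" "t j \<le> t (i + int m - 1)"
      using ij strict_mono_less_eq[OF mono] by auto
    moreover have "?e \<le> t j - t (j - 1)"
      using ij a by (intro gap) auto
    moreover have "?e \<le> t (i + int m) - t (i + int m - 1)"
    \<comment> \<open>The bound \<open>gap\<close> covers the indices 1 to \<open>m\<close>: for
      \<open>i = 0\<close> it applies at \<open>m\<close>, otherwise at \<open>i\<close> after a
      shift by one period.\<close>
    proof (cases "i = 0")
      case True
      then show ?thesis using gap[of "int m"] ij by auto
    next
      case False
      then show ?thesis
        using gap[of i] per[of "i - 1"] per[of i] ij a by (auto simp: algebra_simps)
    qed
    ultimately show "?e \<le> t j - t i" "t j - t i \<le> 1 - ?e"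
      using per[of i] by auto
  qed
  have frac_apart: "?e \<le> \<bar>frac (t j) - frac (t i)\<bar>"
    if ij: "i < j" "i \<in> {a..<a + int m}" "j \<in> {a..<a + int m}" for i j
  proof (rule ccontr)
    \<comment> \<open>Otherwise \<open>t j - t i\<close> would be within less than
      \<open>1 / 2 ^ n\<close> of the integer \<open>q\<close>, which \<open>apart\<close> then
      forces strictly between 0 and 1.\<close>
    assume close: "\<not> ?thesis"
    define q where "q = \<lfloor>t j\<rfloor> - \<lfloor>t i\<rfloor>"
    have "t j - t i = frac (t j) - frac (t i) + of_int q"
      by (simp add: frac_def q_def)
    with close apart[OF ij] have "0 < (of_int q :: real)" "(of_int q :: real) < 1"
      by linarith+
    then show False by simp
  qed
  have "\<exists>k\<in>R. frac (t i) = 1 / 2 ^ k" if "i \<in> ?A" for i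
    using that by (auto simp: dyadic_points_def)
  then obtain k where k: "\<And>i. i \<in> ?A \<Longrightarrow> k i \<in> R \<and> frac (t i) = 1 / 2 ^ k i"
    by metis
  have less: "1 / 2 ^ c < ?e" "0 < (1 / 2 ^ c :: real)" if "n < c" for c
    using that by (auto intro: divide_strict_left_mono)
  \<comment> \<open>Equal labels up to \<open>n\<close> mean equal fractional parts; two points with
    label \<open>Suc n\<close> both lie strictly between 0 and \<open>1 / 2 ^ n\<close>. Either
    contradicts \<open>frac_apart\<close>.\<close>
  have sep: "min (k i) (Suc n) \<noteq> min (k j) (Suc n)" if ij: "i \<in> ?A" "j \<in> ?A" "i < j" for i j
  proof
    assume eq: "min (k i) (Suc n) = min (k j) (Suc n)"
    have far: "?e \<le> \<bar>1 / 2 ^ k j - 1 / 2 ^ k i\<bar>"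
      using frac_apart[of i j] ij k[OF ij(1)] k[OF ij(2)] by simp
    show False
    proof (cases "k i \<le> n")
      case True
      then have "k i = k j" using eq by (auto simp: min_def split: if_splits)
      with far have "?e \<le> 0" by simp
      moreover have "0 < ?e" by simp
      ultimately show False by linarith
    next
      case False
      then have "n < k i" "n < k j" using eq by (auto simp: min_def split: if_splits)
      from less[OF this(1)] less[OF this(2)] far show False by linarith
    qed
  qed
  have inj: "inj_on (\<lambda>i. min (k i) (Suc n)) ?A"
  proof (rule inj_onI, rule ccontr)
    fix i j assume "i \<in> ?A" "j \<in> ?A" "min (k i) (Suc n) = min (k j) (Suc n)" "i \<noteq> j"
    then show False using sep[of i j] sep[of j i] by (cases i j rule: linorder_cases) auto
  qed
  have "card ?A = card ((\<lambda>i. min (k i) (Suc n)) ` ?A)"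
    using inj by (simp add: card_image)
  also have "\<dots> \<le> card (insert (Suc n) (R \<inter> {..n}))"
  proof (rule card_mono)
    show "(\<lambda>i. min (k i) (Suc n)) ` ?A \<subseteq> insert (Suc n) (R \<inter> {..n})"
    proof (rule image_subsetI)
      fix i assume "i \<in> ?A"
      then show "min (k i) (Suc n) \<in> insert (Suc n) (R \<inter> {..n})"
        using k[of i] by (auto simp: min_def)
    qed
  qed simp
  also have "\<dots> \<le> card (R \<inter> {..n}) + 1"
    by simp
  finally show ?thesis .
qed

text \<open>An interval contributes at most 1, and only if one of its endpoints is a dyadic point
  modulo 1. Right endpoints (\<open>?B 0\<close>) and left endpoints (\<open>?B 1\<close>) are
  counted separately.\<close>

lemma dyadic_ind_variation:
  assumes part: "(t, m) \<in> fine_partitions n" and p: "0 < p"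
  shows "(\<Sum>i=1..m. \<bar>incr1 (dyadic_ind R) (part_interval t i) (y i)\<bar> powr p)
    \<le> 2 * real (card (R \<inter> {..n})) + 2"
proof -
  let ?A = "\<lambda>a::int. {i \<in> {a..<a + int m}. frac (t i) \<in> dyadic_points R}"
  let ?B = "\<lambda>e::int. {i \<in> {1..m}. frac (t (int i - e)) \<in> dyadic_points R}"
  have card_B: "card (?B e) \<le> card (R \<inter> {..n}) + 1" if "e \<in> {0, 1}" for e
  proof -
    \<comment> \<open>Left endpoints have indices 0 to \<open>m - 1\<close> and right ones 1 to
      \<open>m\<close>, hence the windows starting at \<open>1 - e\<close>.\<close>
    have "card (?B e) \<le> card (?A (1 - e))"
      by (rule card_inj_on_le[of "\<lambda>i. int i - e"]) (auto simp: inj_on_def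
        intro: finite_subset[of _ "{1 - e..<1 - e + int m}"])
    also have "\<dots> \<le> card (R \<inter> {..n}) + 1"
      using that by (intro card_partition_dyadic_points[OF part]) auto
    finally show ?thesis .
  qed
  have "(\<Sum>i=1..m. \<bar>incr1 (dyadic_ind R) (part_interval t i) (y i)\<bar> powr p)
      \<le> (\<Sum>i=1..m. of_bool (i \<in> ?B 0) + of_bool (i \<in> ?B 1))"
    using p by (intro sum_mono) (auto simp: incr1_def part_interval_def dyadic_ind_def)
  also have "\<dots> = real (card (?B 0)) + real (card (?B 1))"
    by (simp add: sum.distrib sum.If_cases of_bool_def Int_def conj_commute)
  also have "\<dots> \<le> 2 * real (card (R \<inter> {..n})) + 2"
    using card_B[of 0] card_B[of 1] by simp
  finally show ?thesis .
qed

text \<open>A count growing linearly in \<open>p n\<close> has a \<open>p n\<close>-th root bounded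
  independently of \<open>n\<close>.\<close>

lemma dyadic_ind_BV_sharp:
  assumes p: "\<And>n. 1 \<le> n \<Longrightarrow> 1 \<le> p n"
    and R: "\<And>n. 1 \<le> n \<Longrightarrow> real (card (R \<inter> {..n})) \<le> p n + 1"
  shows "dyadic_ind R \<in> BV_sharp p"
proof -
  have "(\<Sum>i=1..m. \<bar>incr1 (dyadic_ind R) (part_interval t i) (y i)\<bar> powr p n) powr (1 / p n) \<le> exp 6"
    if n: "1 \<le> n" and part: "(t, m) \<in> fine_partitions n" for y n t m
  proof -
    \<comment> \<open>The bound is \<open>2 * (p n + 1) + 2\<close>, and \<open>1 \<le> p n\<close>
      absorbs the constant 4. The exponential then makes the root exactly
      \<open>exp 6\<close>.\<close>
    have "(\<Sum>i=1..m. \<bar>incr1 (dyadic_ind R) (part_interval t i) (y i)\<bar> powr p n) \<le> 6 * p n"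
      using dyadic_ind_variation[OF part, of "p n" R y] p[OF n] R[OF n] by linarith
    also have "\<dots> \<le> exp (6 * p n)"
      using exp_ge_add_one_self[of "6 * p n"] by linarith
    finally have "(\<Sum>i=1..m. \<bar>incr1 (dyadic_ind R) (part_interval t i) (y i)\<bar> powr p n) powr (1 / p n)
        \<le> exp (6 * p n) powr (1 / p n)"
      using p[OF n] by (intro powr_mono2) (auto intro: sum_nonneg)
    also have "\<dots> = exp 6"
      using p[OF n] by (simp add: powr_def)
    finally show ?thesis .
  qed
  then have "BV_V1 p (dyadic_ind R) \<le> ennreal (exp 6)"
    unfolding BV_V1_def by (intro SUP_least) (auto intro: ennreal_leI)
  then have "BV_V1 p (dyadic_ind R) < \<infinity>"
    using le_less_trans by fastforce
  moreover have "BV_V2 p (dyadic_ind R) \<le> 0"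
    unfolding BV_V2_def by (intro SUP_least) (auto simp: incr2_def dyadic_ind_def)
  ultimately show ?thesis
    using dyadic_ind_measurable by (simp add: BV_sharp_def)
qed

section \<open>Lower bound for the Lambda-variation of dyadic indicators\<close>

lemma Lambda_V1_dyadic_ind_ge:
  fixes r :: "nat \<Rightarrow> nat"
  assumes r: "strict_mono r" "\<And>j. 1 \<le> r j"
  shows "(\<Sum>\<^sub>\<infinity>i\<in>{1..}. ennreal (1 / lam i)) \<le> Lambda_V1 lam (dyadic_ind (range r))"
proof -
  \<comment> \<open>The factor \<open>3 / 2\<close> puts the right endpoint strictly between
    consecutive powers of 1/2: it is not a dyadic point, and the intervals stay disjoint. As
    \<open>1 \<le> r i\<close>, it is at most \<open>3 / 4\<close>, so \<open>frac\<close> fixes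
    both endpoints.\<close>
  define J :: "nat \<Rightarrow> real \<times> real" where "J i = (1 / 2 ^ r i, 3 / 2 * (1 / 2 ^ r i))" for i
  have half: "2 * (1 / 2 ^ b) \<le> (1 / 2 ^ a :: real)" if "a < b" for a b :: nat
  proof -
    have "(1 / 2 ^ b :: real) \<le> 1 / 2 ^ Suc a"
      using that by (intro divide_left_mono power_increasing) auto
    then show ?thesis by simp
  qed
  have pos: "0 < (1 / 2 ^ k :: real)" for k :: nat by simp
  have le: "1 / 2 ^ r i \<le> (1 / 2 :: real)" for i
    using half[of 0 "r i"] r(2)[of i] by auto
  have "disjoint_family_on (\<lambda>i. {fst (J i)<..<snd (J i)}) {1..}"
  proof -
    have "{fst (J i)<..<snd (J i)} \<inter> {fst (J j)<..<snd (J j)} = {}" if "i < j" for i j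
      using half[of "r i" "r j"] strict_monoD[OF r(1) that] pos[of "r j"] by (auto simp: J_def)
    then show ?thesis
      unfolding disjoint_family_on_def by (metis Int_commute nat_neq_iff)
  qed
  moreover have "0 \<le> fst (J i) \<and> fst (J i) < snd (J i) \<and> snd (J i) \<le> 1" for i
    using pos[of "r i"] le[of i] unfolding J_def fst_conv snd_conv by linarith
  ultimately have J: "({1..}, J) \<in> interval_collections"
    unfolding interval_collections_def by blast
  have incr: "\<bar>incr1 (dyadic_ind (range r)) (J i) 0\<bar> = 1" for i
  proof -
    have fr: "frac (fst (J i)) = fst (J i)" "frac (snd (J i)) = snd (J i)"
      using le[of i] pos[of "r i"] by (simp_all add: J_def frac_eq)
    have "snd (J i) \<noteq> 1 / 2 ^ k" for k
    proof (cases k "r i" rule: linorder_cases)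
      case less
      with half[OF less] pos[of "r i"] show ?thesis unfolding J_def snd_conv by linarith
    next
      case greater
      with half[OF greater] pos[of "r i"] pos[of k] show ?thesis unfolding J_def snd_conv by linarith
    next
      case equal
      with pos[of "r i"] show ?thesis unfolding J_def snd_conv equal by linarith
    qed
    then have "snd (J i) \<notin> dyadic_points (range r)"
      by (auto simp: dyadic_points_def)
    moreover have "fst (J i) \<in> dyadic_points (range r)"
      by (auto simp: dyadic_points_def J_def)
    ultimately show ?thesis
      by (simp add: incr1_def dyadic_ind_def fr)
  qed
  have "(\<lambda>_. 0) \<in> unit_points" by (intro const_unit_points) simp
  from Lambda_V1_ge[OF this J, of "dyadic_ind (range r)" lam] show ?thesis
    by (simp add: incr)
qed

section \<open>Choice of sparse exponents\<close>

lemma ex_strict_mono_ge: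
  fixes p :: "nat \<Rightarrow> real"
  assumes "filterlim p at_top sequentially"
  shows "\<exists>r. strict_mono r \<and> (\<forall>j. 1 \<le> r j \<and> real j \<le> p (r j))"
proof -
  have "\<exists>k>l. 1 \<le> k \<and> real j \<le> p k" for l j
  proof -
    have "eventually (\<lambda>k. real j \<le> p k) sequentially"
      using assms by (simp add: filterlim_at_top)
    then have "eventually (\<lambda>k. real j \<le> p k \<and> l < k) sequentially"
      using eventually_gt_at_top by (rule eventually_conj)
    then obtain k where "real j \<le> p k" "l < k"
      by (auto simp: eventually_sequentially)
    then show ?thesis by (intro exI[of _ k]) auto
  qed
  then have "\<exists>r. \<forall>j. (1 \<le> r j \<and> real j \<le> p (r j)) \<and> r j < r (Suc j)"
    by (intro dependent_nat_choice) (meson, metis)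
  then show ?thesis by (auto simp: strict_mono_Suc_iff)
qed

text \<open>If \<open>r j \<le> n\<close>, monotonicity gives
  \<open>j \<le> p (r j) \<le> p n\<close>; the \<open>+ 1\<close> accounts for the index
  \<open>j = 0\<close>.\<close>

lemma card_range_le:
  fixes p :: "nat \<Rightarrow> real"
  assumes r: "strict_mono r" "\<And>j. 1 \<le> r j \<and> real j \<le> p (r j)"
    and p: "mono_on {1..} p" "1 \<le> n" "0 \<le> p n"
  shows "real (card (range r \<inter> {..n})) \<le> p n + 1"
proof -
  have "range r \<inter> {..n} \<subseteq> r ` {..nat \<lfloor>p n\<rfloor>}"
  proof
    fix k assume "k \<in> range r \<inter> {..n}"
    then obtain j where j: "k = r j" "r j \<le> n" by auto
    then have "real j \<le> p n"
      using r(2)[of j] mono_onD[OF p(1), of "r j" n] p(2) by auto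
    then show "k \<in> r ` {..nat \<lfloor>p n\<rfloor>}"
      using j by (auto simp: le_nat_iff le_floor_iff)
  qed
  then have "card (range r \<inter> {..n}) \<le> card {..nat \<lfloor>p n\<rfloor>}"
    by (meson card_image_le card_mono finite_atMost finite_imageI le_trans)
  then show ?thesis using p(3) of_int_floor_le[of "p n"] by simp linarith
qed

theorem corollary1:
  fixes lam p :: "nat \<Rightarrow> real"
  assumes "1 < lam 1"
    and "mono_on {1..} lam"
    and "filterlim lam at_top sequentially"
    and "mono_on {1..} p"
    and "\<forall>n\<ge>1. 1 \<le> p n"
    and "filterlim p at_top sequentially"
  shows "BV_sharp p \<subseteq> Lambda_BV lam \<longleftrightarrow> Lambda_BV lam = bounded_functions"
proof
  assume sub: "BV_sharp p \<subseteq> Lambda_BV lam"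
  obtain r where r: "strict_mono r" "\<And>j. 1 \<le> r j \<and> real j \<le> p (r j)"
    using ex_strict_mono_ge[OF assms(6)] by blast
  have "real (card (range r \<inter> {..n})) \<le> p n + 1" if "1 \<le> n" for n
    using card_range_le[OF r assms(4) that] assms(5) that by force
  then have "dyadic_ind (range r) \<in> BV_sharp p"
    using assms(5) by (intro dyadic_ind_BV_sharp) auto
  \<comment> \<open>A single test function suffices: its finite variation forces the reciprocals to
    be summable, a condition on \<open>lam\<close> alone that admits every bounded function.\<close>
  with sub have "Lambda_V1 lam (dyadic_ind (range r)) < \<infinity>"
    by (auto simp: Lambda_BV_def)
  then have "(\<Sum>\<^sub>\<infinity>i\<in>{1..}. ennreal (1 / lam i)) < \<infinity>"
    using Lambda_V1_dyadic_ind_ge[of r lam] r le_less_trans by blast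
  moreover have "0 < lam i" if "1 \<le> i" for i
    using mono_onD[OF assms(2), of 1 i] assms(1) that by auto
  ultimately have "bounded_functions \<subseteq> Lambda_BV lam"
    by (intro bounded_functions_subset_Lambda_BV)
  then show "Lambda_BV lam = bounded_functions"
    using Lambda_BV_bounded[of lam] assms(1) by auto
next
  assume "Lambda_BV lam = bounded_functions"
  then show "BV_sharp p \<subseteq> Lambda_BV lam"
    using BV_sharp_bounded[of p] assms(5) by auto
qed

end
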